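(* Let $\alpha\in\mathbb{R}$ and let $Z$ be a real random variable with $Z\sim BASLG_2(\alpha)$. Then for $-1<t<1$ the moment generating function $M_Z(t)=E(e^{tZ})$ is given by $$M_Z(t)=\frac{1}{C_2(\alpha)}\,\pi\csc(\pi t)\Big[-8\alpha+12\pi^2\alpha^3+t\,(4-8\pi^2\alpha^2+\pi^4\alpha^4)+4\pi\alpha\Big(\big(-4\alpha+\pi^2\alpha^3+t(2-\pi^2\alpha^2)\big)\cot(\pi t)+\pi\alpha\big(-6\alpha+t(4-5\pi^2\alpha^2)+6\pi(t-\alpha)\alpha\cot(\pi t)\big)\csc^2(\pi t)+6\pi^3 t\,\alpha^3\csc^4(\pi t)\Big)\Big],$$ where at $t=0$ the right-hand side is understood as its limit as $t\to 0$.
   Context: For $\alpha\in\mathbb{R}$, $BASLG_2(\alpha)$ (the Balakrishnan alpha skew logistic distribution with skewness parameter $\alpha$) is the continuous distribution on $\mathbb{R}$ with probability density function $$f_Z(z;\alpha)=\frac{[(1-\alpha z)^2+1]^2}{C_2(\alpha)}\,\frac{e^{-z}}{(1+e^{-z})^2},\quad z\in\mathbb{R},\qquad C_2(\alpha)=4+\frac{8\pi^2\alpha^2}{3}+\frac{7\pi^4\alpha^4}{15}.$$ *)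

theory Defs
  imports "HOL-Probability.Probability"
begin

definition csc :: "real \<Rightarrow> real"
  where "csc x = 1 / sin x"

definition C2 :: "real \<Rightarrow> real"
  where "C2 \<alpha> = 4 + 8 * pi\<^sup>2 * \<alpha>\<^sup>2 / 3 + 7 * pi ^ 4 * \<alpha> ^ 4 / 15"

definition baslg2_density :: "real \<Rightarrow> real \<Rightarrow> real"
  where "baslg2_density \<alpha> z =
    ((1 - \<alpha> * z)\<^sup>2 + 1)\<^sup>2 / C2 \<alpha> * (exp (- z) / (1 + exp (- z))\<^sup>2)"

definition baslg2_distributed :: "'a measure \<Rightarrow> ('a \<Rightarrow> real) \<Rightarrow> real \<Rightarrow> bool"
  where "baslg2_distributed M Z \<alpha> \<longleftrightarrow>
    distributed M lborel Z (\<lambda>z. ennreal (baslg2_density \<alpha> z))"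

(* A Bochner integral, hence 0 when the exponential moment does not exist;
   statements about its value should be paired with integrability. *)
definition mgf :: "'a measure \<Rightarrow> ('a \<Rightarrow> real) \<Rightarrow> real \<Rightarrow> real"
  where "mgf M Z t = (LINT \<omega>|M. exp (t * Z \<omega>))"

(* Meaningful for non-integer t only: at t = 0 both csc and cot have the junk value 0,
   so the value there has to be taken as the limit for t tending to 0. *)
definition baslg2_mgf_formula :: "real \<Rightarrow> real \<Rightarrow> real"
  where "baslg2_mgf_formula \<alpha> t =
    1 / C2 \<alpha> * pi * csc (pi * t) *
    (- 8 * \<alpha> + 12 * pi\<^sup>2 * \<alpha> ^ 3 + t * (4 - 8 * pi\<^sup>2 * \<alpha>\<^sup>2 + pi ^ 4 * \<alpha> ^ 4)
     + 4 * pi * \<alpha> *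
       ((- 4 * \<alpha> + pi\<^sup>2 * \<alpha> ^ 3 + t * (2 - pi\<^sup>2 * \<alpha>\<^sup>2)) * cot (pi * t)
        + pi * \<alpha> *
          (- 6 * \<alpha> + t * (4 - 5 * pi\<^sup>2 * \<alpha>\<^sup>2)
           + 6 * pi * (t - \<alpha>) * \<alpha> * cot (pi * t)) * (csc (pi * t))\<^sup>2
        + 6 * pi ^ 3 * t * \<alpha> ^ 3 * (csc (pi * t)) ^ 4))"

end

theory Submission
  imports Defs
begin

text \<open>
The factor \<open>((1 - \<alpha> z)\<^sup>2 + 1)\<^sup>2\<close> in the density is a quartic polynomial in \<open>z\<close>, namely
\<open>4 - 8 \<alpha> z + 8 \<alpha>\<^sup>2 z\<^sup>2 - 4 \<alpha>\<^sup>3 z\<^sup>3 + \<alpha>\<^sup>4 z\<^sup>4\<close>, and it multiplies the standard logistic density.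
Hence \<open>C\<^sub>2(\<alpha>) M\<^sub>Z(t)\<close> is the corresponding combination of the moments
\<open>m\<^sub>n(t) = \<integral> z\<^sup>n e\<^bsup>tz\<^esup> \<rho>(z) dz\<close>, \<open>n \<le> 4\<close>, of the logistic density \<open>\<rho>\<close>.

The moment \<open>m\<^sub>0\<close> is a Beta integral: with \<open>u = 1 / (1 + e\<^bsup>-z\<^esup>)\<close> one has \<open>du = \<rho>(z) dz\<close> and
\<open>u / (1 - u) = e\<^bsup>z\<^esup>\<close>, so \<open>m\<^sub>0(t) = B(1 + t, 1 - t)\<close>, which is \<open>\<pi> t csc (\<pi> t)\<close> by Euler's reflection
formula (\<open>logistic_exponential_moment\<close>, \<open>Beta_reflection\<close>).

Dominated convergence gives \<open>m\<^sub>n' = m\<^sub>n\<^sub>+\<^sub>1\<close> on the open interval where all the exponential moments exist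
(\<open>has_real_derivative_integral_power_times_exp\<close>).  So the moments up to order four are the first four
derivatives of \<open>\<pi> t csc (\<pi> t)\<close>.  They are written with \<open>csc\<close> and \<open>cot\<close> by means of
\<open>csc' = - csc cot\<close>, \<open>cot' = - csc\<^sup>2\<close> and \<open>cot\<^sup>2 = csc\<^sup>2 - 1\<close> (\<open>logistic_moments\<close>), after which
the asserted formula for \<open>t \<noteq> 0\<close> is a polynomial identity.

At \<open>t = 0\<close> the moments remain differentiable, hence continuous, so the formula tends to the value
of the moment generating function there.
\<close>

section \<open>Differentiating exponential moments under the integral\<close>

lemma exp_mult_abs_le:
  fixes d h x :: real
  assumes "\<bar>h\<bar> \<le> d"
  shows "exp (h * x) \<le> exp (d * x) + exp (- d * x)"
proof -
  have "h * x \<le> \<bar>d * x\<bar>"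
  proof -
    have "h * x \<le> \<bar>h\<bar> * \<bar>x\<bar>" by (simp flip: abs_mult)
    also have "\<dots> \<le> \<bar>d\<bar> * \<bar>x\<bar>" using assms by (intro mult_right_mono) auto
    finally show ?thesis by (simp add: abs_mult)
  qed
  then consider "h * x \<le> d * x" | "h * x \<le> - d * x" by linarith
  then show ?thesis
    by cases (simp_all add: add_increasing add_increasing2)
qed

lemma abs_exp_minus_one_le:
  fixes u :: real
  shows "\<bar>exp u - 1\<bar> \<le> \<bar>u\<bar> * exp \<bar>u\<bar>"
proof (cases "u \<ge> 0")
  case True
  have "exp u * (1 - u) \<le> exp u * exp (- u)"
    using exp_ge_add_one_self[of "- u"] by (intro mult_left_mono) auto
  then show ?thesis using True by (simp add: algebra_simps flip: exp_add)
next
  case False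
  have "\<bar>exp u - 1\<bar> \<le> \<bar>u\<bar> * 1"
    using False exp_ge_add_one_self[of u] by (simp del: exp_ge_add_one_self)
  also have "\<dots> \<le> \<bar>u\<bar> * exp \<bar>u\<bar>" by (intro mult_left_mono) auto
  finally show ?thesis .
qed

text \<open>This makes the difference quotients of \<open>s \<mapsto> e\<^bsup>sx\<^esup>\<close> at a point \<open>t\<close> bounded, uniformly in
  the increment \<open>h\<close>, by \<open>\<bar>x\<bar>\<close> times exponentials with exponents shifted to \<open>t \<plusminus> d\<close>.
  A sum of the two exponentials stands in for \<open>e\<^bsup>d\<bar>x\<bar>\<^esup>\<close>, because the hypothesis in the lemmas below
  is the integrability of \<open>e\<^bsup>sX\<^esup>\<close> for either sign of the exponent.\<close>
lemma abs_exp_increment_le: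
  fixes d h x :: real
  assumes "\<bar>h\<bar> \<le> d"
  shows "\<bar>exp (h * x) - 1\<bar> \<le> \<bar>h\<bar> * \<bar>x\<bar> * (exp (d * x) + exp (- d * x))"
proof -
  have "exp \<bar>h * x\<bar> \<le> exp (d * x) + exp (- d * x)"
    using exp_mult_abs_le[of h d x] exp_mult_abs_le[of "- h" d x] assms
    by (cases "h * x \<ge> 0") (simp_all add: abs_of_nonneg abs_of_neg)
  then have "\<bar>h * x\<bar> * exp \<bar>h * x\<bar> \<le> \<bar>h * x\<bar> * (exp (d * x) + exp (- d * x))"
    by (rule mult_left_mono) simp
  with abs_exp_minus_one_le[of "h * x"] show ?thesis by (simp add: abs_mult)
qed

context
  fixes N :: "'a measure" and X :: "'a \<Rightarrow> real" and a b :: real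
  assumes X [measurable]: "X \<in> borel_measurable N"
    and exp_integrable: "\<And>s. a < s \<Longrightarrow> s < b \<Longrightarrow> integrable N (\<lambda>\<omega>. exp (s * X \<omega>))"
begin

text \<open>A factor \<open>\<bar>X\<bar>\<close> costs an arbitrarily small shift of the exponent, since
  \<open>d \<bar>x\<bar> \<le> e\<^bsup>d\<bar>x\<bar>\<^esup> \<le> e\<^bsup>dx\<^esup> + e\<^bsup>-dx\<^esup>\<close>, and an open interval leaves room for such a shift on both sides.
  Thus the powers can be added one at a time.\<close>
lemma integrable_power_times_exp:
  assumes "a < t" "t < b"
  shows "integrable N (\<lambda>\<omega>. X \<omega> ^ n * exp (t * X \<omega>))"
  using assms
proof (induction n arbitrary: t)
  case 0
  then show ?case using exp_integrable by simp
next
  case (Suc n)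
  define d where "d = min (t - a) (b - t) / 2"
  have d: "d > 0" "a < t - d" "t + d < b"
    using Suc.prems by (auto simp: d_def min_def field_simps)
  have "integrable N (\<lambda>\<omega>. (\<bar>X \<omega> ^ n * exp ((t + d) * X \<omega>)\<bar> + \<bar>X \<omega> ^ n * exp ((t - d) * X \<omega>)\<bar>) / d)"
    using Suc.IH[of "t + d"] Suc.IH[of "t - d"] d by (intro integrable_divide Bochner_Integration.integrable_add integrable_abs) auto
  then show ?case
  proof (rule Bochner_Integration.integrable_bound)
    show "AE \<omega> in N. norm (X \<omega> ^ Suc n * exp (t * X \<omega>))
        \<le> norm ((\<bar>X \<omega> ^ n * exp ((t + d) * X \<omega>)\<bar> + \<bar>X \<omega> ^ n * exp ((t - d) * X \<omega>)\<bar>) / d)"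
    proof (rule AE_I2)
      fix \<omega>
      define x where "x = X \<omega>"
      have "d * \<bar>x\<bar> \<le> exp (d * \<bar>x\<bar>)"
        using exp_ge_add_one_self[of "d * \<bar>x\<bar>"] by linarith
      also have "\<dots> \<le> exp (d * x) + exp (- d * x)"
        by (auto simp: abs_if)
      finally have "\<bar>x\<bar> ^ n * exp (t * x) * (d * \<bar>x\<bar>) \<le> \<bar>x\<bar> ^ n * exp (t * x) * (exp (d * x) + exp (- d * x))"
        by (rule mult_left_mono) simp
      also have "\<dots> = \<bar>x\<bar> ^ n * exp ((t + d) * x) + \<bar>x\<bar> ^ n * exp ((t - d) * x)"
        by (simp add: algebra_simps exp_add exp_diff exp_minus divide_inverse)
      finally show "norm (X \<omega> ^ Suc n * exp (t * X \<omega>))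
        \<le> norm ((\<bar>X \<omega> ^ n * exp ((t + d) * X \<omega>)\<bar> + \<bar>X \<omega> ^ n * exp ((t - d) * X \<omega>)\<bar>) / d)"
        using d by (simp add: x_def[symmetric] abs_mult power_abs field_simps)
    qed
  qed measurable
qed

text \<open>The difference quotients with increments below \<open>d\<close> are dominated by
  \<open>\<bar>X\<bar>\<^bsup>n+1\<^esup> (e\<^bsup>(t+d)X\<^esup> + e\<^bsup>(t-d)X\<^esup>)\<close>, which is integrable as long as \<open>t \<plusminus> d\<close> stay in the interval.\<close>
lemma has_real_derivative_integral_power_times_exp:
  assumes "a < t" "t < b"
  shows "((\<lambda>s. LINT \<omega>|N. X \<omega> ^ n * exp (s * X \<omega>)) has_real_derivative
           (LINT \<omega>|N. X \<omega> ^ Suc n * exp (t * X \<omega>))) (at t)"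
proof -
  define d where "d = min (t - a) (b - t) / 2"
  have d: "d > 0" "a < t - d" "t + d < b"
    using assms by (auto simp: d_def min_def field_simps)
  let ?S = "{t - d<..<t + d}"
  let ?M = "\<lambda>n s. LINT \<omega>|N. X \<omega> ^ n * exp (s * X \<omega>)"
  let ?w = "\<lambda>\<omega>. \<bar>X \<omega> ^ Suc n * exp ((t + d) * X \<omega>)\<bar> + \<bar>X \<omega> ^ Suc n * exp ((t - d) * X \<omega>)\<bar>"
  \<comment> \<open>Restricting to \<open>?S\<close> makes the bound hold along the whole sequence and not just eventually,
     as the sequential form of dominated convergence demands.\<close>
  have "((\<lambda>s. (?M n s - ?M n t) / (s - t)) \<longlongrightarrow> ?M (Suc n) t) (at t within ?S)"
    unfolding tendsto_at_iff_sequentially comp_def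
  proof (intro allI impI)
    fix s :: "nat \<Rightarrow> real"
    assume s: "\<forall>i. s i \<in> ?S - {t}" and lim: "s \<longlonglongrightarrow> t"
    let ?q = "\<lambda>i \<omega>. (X \<omega> ^ n * exp (s i * X \<omega>) - X \<omega> ^ n * exp (t * X \<omega>)) / (s i - t)"
    have "(\<lambda>i. LINT \<omega>|N. ?q i \<omega>) \<longlonglongrightarrow> ?M (Suc n) t"
    proof (rule integral_dominated_convergence)
      show "integrable N ?w"
        using d by (intro Bochner_Integration.integrable_add integrable_abs integrable_power_times_exp) auto
      show "AE \<omega> in N. (\<lambda>i. ?q i \<omega>) \<longlonglongrightarrow> X \<omega> ^ Suc n * exp (t * X \<omega>)"
      proof (rule AE_I2)
        fix \<omega>
        have "((\<lambda>s. X \<omega> ^ n * exp (s * X \<omega>)) has_real_derivative X \<omega> ^ Suc n * exp (t * X \<omega>)) (at t)"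
          by (auto intro!: derivative_eq_intros)
        then have "((\<lambda>s. (X \<omega> ^ n * exp (s * X \<omega>) - X \<omega> ^ n * exp (t * X \<omega>)) / (s - t))
            \<longlongrightarrow> X \<omega> ^ Suc n * exp (t * X \<omega>)) (at t)"
          by (simp add: has_field_derivative_iff)
        then show "(\<lambda>i. ?q i \<omega>) \<longlonglongrightarrow> X \<omega> ^ Suc n * exp (t * X \<omega>)"
          using s lim unfolding tendsto_at_iff_sequentially comp_def by auto
      qed
      show "AE \<omega> in N. norm (?q i \<omega>) \<le> ?w \<omega>" for i
      proof (rule AE_I2)
        fix \<omega>
        define x h where "x = X \<omega>" and "h = s i - t"
        have h: "\<bar>h\<bar> \<le> d" "h \<noteq> 0" "s i = t + h"
          using s[rule_format, of i] by (auto simp: h_def abs_if)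
        have "\<bar>x ^ n * exp (s i * x) - x ^ n * exp (t * x)\<bar> = \<bar>x\<bar> ^ n * exp (t * x) * \<bar>exp (h * x) - 1\<bar>"
        proof -
          have "x ^ n * exp (s i * x) - x ^ n * exp (t * x) = x ^ n * exp (t * x) * (exp (h * x) - 1)"
            by (simp add: h algebra_simps exp_add)
          then show ?thesis by (simp add: abs_mult power_abs)
        qed
        also have "\<dots> \<le> \<bar>x\<bar> ^ n * exp (t * x) * (\<bar>h\<bar> * \<bar>x\<bar> * (exp (d * x) + exp (- d * x)))"
          using h by (intro mult_left_mono abs_exp_increment_le) auto
        also have "\<dots> = (\<bar>x\<bar> ^ Suc n * exp ((t + d) * x) + \<bar>x\<bar> ^ Suc n * exp ((t - d) * x)) * \<bar>h\<bar>"
          by (simp add: algebra_simps exp_add exp_diff exp_minus divide_inverse)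
        finally show "norm (?q i \<omega>) \<le> ?w \<omega>"
          using h(2) by (simp add: x_def[symmetric] h_def[symmetric] abs_mult power_abs pos_divide_le_eq)
      qed
    qed measurable
    moreover have "(LINT \<omega>|N. ?q i \<omega>) = (?M n (s i) - ?M n t) / (s i - t)" for i
      using s[rule_format, of i] d assms
      by (subst integral_divide_zero, subst Bochner_Integration.integral_diff)
         (auto intro!: integrable_power_times_exp)
    ultimately show "(\<lambda>i. (?M n (s i) - ?M n t) / (s i - t)) \<longlonglongrightarrow> ?M (Suc n) t"
      by (simp only:)
  qed
  then have "(?M n has_real_derivative ?M (Suc n) t) (at t within ?S)"
    by (simp add: has_field_derivative_iff)
  then show ?thesis
    using d by (simp add: at_within_open[of t ?S])
qed

end

section \<open>The logistic distribution and its moment generating function\<close>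

definition logistic_density :: "real \<Rightarrow> real"
  where "logistic_density z = exp (- z) / (1 + exp (- z))\<^sup>2"

text \<open>Since \<open>\<Gamma>(2) = 1\<close>, the left-hand side is \<open>\<Gamma>(1 + t) \<Gamma>(1 - t) = t \<Gamma>(t) \<Gamma>(1 - t)\<close>, to which
  Euler's reflection formula applies.  At \<open>t = 0\<close> the value is \<open>1\<close>, but the quotient is \<open>0 / 0 = 0\<close>.\<close>
lemma Beta_reflection:
  fixes t :: real
  assumes "- 1 < t" "t < 1" "t \<noteq> 0"
  shows "Beta (1 + t) (1 - t) = pi * t / sin (pi * t)"
proof -
  have nonint: "t \<notin> \<int>\<^sub>\<le>\<^sub>0"
    using assms by (auto simp: nonpos_Ints_def)
  have "complex_of_real (Gamma t * Gamma (1 - t)) = Gamma (of_real t) * Gamma (1 - of_real t)"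
    by (simp flip: Gamma_complex_of_real)
  also have "\<dots> = of_real (pi / sin (pi * t))"
    by (subst Gamma_reflection_complex) (simp flip: sin_of_real)
  finally have "Gamma t * Gamma (1 - t) = pi / sin (pi * t)"
    by (simp only: of_real_eq_iff)
  moreover have "Gamma (1 + t) = t * Gamma t"
    using Gamma_plus1[OF nonint] by (simp add: add.commute)
  moreover have "Gamma (2 :: real) = 1"
    using Gamma_fact[of 1, where 'a = real] by simp
  ultimately show ?thesis
    by (simp add: Beta_def mult.assoc)
qed

lemma logistic_density_nonneg: "0 \<le> logistic_density z"
  by (simp add: logistic_density_def)

lemma borel_measurable_logistic_density [measurable]:
  "logistic_density \<in> borel_measurable borel"
  unfolding logistic_density_def[abs_def] by measurable

text \<open>The logistic density is the derivative of the logistic distribution function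
  \<open>g(z) = 1 / (1 + e\<^bsup>-z\<^esup>)\<close>, a bijection from the line to \<open>]0,1[\<close> with \<open>g / (1 - g) = e\<^bsup>z\<^esup>\<close>.  The
  substitution \<open>u = g(z)\<close> therefore turns the Beta integrand \<open>u\<^bsup>t\<^esup> (1 - u)\<^bsup>-t\<^esup>\<close> into the one wanted here.\<close>
lemma logistic_exponential_moment:
  fixes t :: real
  assumes "- 1 < t" "t < 1"
  shows "has_bochner_integral lborel (\<lambda>z. logistic_density z * exp (t * z)) (Beta (1 + t) (1 - t))"
proof -
  define g :: "real \<Rightarrow> real" where "g z = 1 / (1 + exp (- z))" for z
  let ?f = "\<lambda>u::real. u powr t * (1 - u) powr (- t)"
  have pos: "1 + exp (- z) > 0" for z :: real
    by (simp add: add_pos_pos)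
  have deriv: "(g has_field_derivative logistic_density z) (at z within UNIV)" for z
    unfolding g_def[abs_def] logistic_density_def
    using pos[of z] by (auto intro!: derivative_eq_intros simp: power2_eq_square)
  have "inj g"
    using pos by (auto simp: inj_on_def g_def)
  have range: "range g = {0<..<1}"
  proof safe
    fix u :: real assume u: "u \<in> {0<..<1}"
    then have "u = g (ln (u / (1 - u)))"
      by (simp add: g_def exp_minus field_simps)
    then show "u \<in> range g" by blast
  qed (use pos in \<open>auto simp: g_def\<close>)
  have transformed: "\<bar>logistic_density z\<bar> * ?f (g z) = logistic_density z * exp (t * z)" for z
  proof -
    have "1 - g z = exp (- z) * g z"
      using pos[of z] by (simp add: g_def field_simps)
    moreover have "g z > 0" using pos by (simp add: g_def)
    ultimately have "?f (g z) = g z powr t * (exp (t * z) * g z powr (- t))"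
      by (simp only:) (simp add: powr_mult exp_powr_real mult.commute)
    also have "\<dots> = exp (t * z)"
      using \<open>g z > 0\<close> by (simp add: powr_minus)
    finally have "?f (g z) = exp (t * z)" .
    then show ?thesis by (simp add: logistic_density_nonneg)
  qed
  have "(?f has_integral Beta (1 + t) (1 - t)) {0<..<1}"
    using has_integral_Beta_real[of "1 + t" "1 - t"] assms
    by (simp add: has_integral_Icc_iff_Ioo)
  moreover from this have "?f absolutely_integrable_on {0<..<1}"
    by (intro nonnegative_absolutely_integrable_1) (auto simp: has_integral_integrable)
  ultimately have "(\<lambda>z. \<bar>logistic_density z\<bar> * ?f (g z)) absolutely_integrable_on UNIV \<and>
      integral UNIV (\<lambda>z. \<bar>logistic_density z\<bar> * ?f (g z)) = Beta (1 + t) (1 - t)"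
    using deriv \<open>inj g\<close>
    by (subst has_absolute_integral_change_of_variables_1')
       (auto simp: range integral_unique)
  then have "(\<lambda>z. logistic_density z * exp (t * z)) absolutely_integrable_on UNIV"
    and "integral UNIV (\<lambda>z. logistic_density z * exp (t * z)) = Beta (1 + t) (1 - t)"
    unfolding transformed by auto
  moreover from this(1) have "integrable lborel (\<lambda>z. logistic_density z * exp (t * z))"
    by (simp add: set_integrable_def integrable_completion)
  ultimately show ?thesis
    using integral_lborel[of "\<lambda>z. logistic_density z * exp (t * z)"]
    by (simp add: has_bochner_integral_iff)
qed


definition logistic :: "real measure"
  where "logistic = density lborel (\<lambda>z. ennreal (logistic_density z))"

definition logistic_moment :: "nat \<Rightarrow> real \<Rightarrow> real"
  where "logistic_moment n t = (LINT z|logistic. z ^ n * exp (t * z))"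

lemma integrable_logistic_iff:
  assumes "f \<in> borel_measurable borel"
  shows "integrable logistic f \<longleftrightarrow> integrable lborel (\<lambda>z. logistic_density z * f z)"
  using assms unfolding logistic_def
  by (subst integrable_real_density) (auto simp: logistic_density_nonneg)

lemma integral_logistic:
  assumes "f \<in> borel_measurable borel"
  shows "integral\<^sup>L logistic f = (LINT z|lborel. logistic_density z * f z)"
  using assms unfolding logistic_def
  by (subst integral_real_density) (auto simp: logistic_density_nonneg)

lemma integrable_logistic_exp:
  assumes "- 1 < t" "t < 1"
  shows "integrable logistic (\<lambda>z. exp (t * z))"
  using logistic_exponential_moment[OF assms]
  by (simp add: integrable_logistic_iff has_bochner_integral_iff)

lemma id_borel_measurable_logistic: "(\<lambda>z. z) \<in> borel_measurable logistic"
  by (simp add: logistic_def)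

lemma integrable_logistic_power_times_exp:
  assumes "- 1 < t" "t < 1"
  shows "integrable logistic (\<lambda>z. z ^ n * exp (t * z))"
  using integrable_power_times_exp[OF id_borel_measurable_logistic integrable_logistic_exp assms]
  by simp

lemma DERIV_logistic_moment:
  assumes "- 1 < t" "t < 1"
  shows "(logistic_moment n has_real_derivative logistic_moment (Suc n) t) (at t)"
  using has_real_derivative_integral_power_times_exp
      [OF id_borel_measurable_logistic integrable_logistic_exp assms, of n]
  by (simp add: logistic_moment_def[abs_def])

section \<open>Closed forms of the logistic moments\<close>

text \<open>A closed form of one moment on an open set yields the next one by differentiation.
  The open set is a parameter because the closed forms fail at \<open>0\<close>.\<close>
lemma logistic_moment_Suc_eq:
  assumes "open S" "S \<subseteq> {- 1<..<1}" "t \<in> S"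
    and "\<And>s. s \<in> S \<Longrightarrow> logistic_moment n s = f s"
    and "(f has_real_derivative D) (at t)"
  shows "logistic_moment (Suc n) t = D"
proof -
  have "(f has_real_derivative logistic_moment (Suc n) t) (at t)"
    using assms by (intro has_field_derivative_transform_within_open[OF DERIV_logistic_moment]) auto
  then show ?thesis
    using assms(5) DERIV_unique by blast
qed

lemma sin_pi_times_nonzero:
  fixes t :: real
  assumes "- 1 < t" "t < 1" "t \<noteq> 0"
  shows "sin (pi * t) \<noteq> 0"
proof -
  have "sin (pi * \<bar>t\<bar>) > 0"
    using assms by (intro sin_gt_zero) auto
  then show ?thesis by (cases "t \<ge> 0") auto
qed

lemma DERIV_csc:
  assumes "sin x \<noteq> 0"
  shows "(csc has_real_derivative - csc x * cot x) (at x)"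
  unfolding csc_def[abs_def] cot_def using assms
  by (auto intro!: derivative_eq_intros simp: field_simps power2_eq_square)

lemma DERIV_cot_csc:
  assumes "sin x \<noteq> (0 :: real)"
  shows "(cot has_real_derivative - (csc x)\<^sup>2) (at x)"
  using DERIV_cot[OF assms] by (simp add: csc_def field_simps)

lemma cot_squared:
  assumes "sin x \<noteq> 0"
  shows "(cot x)\<^sup>2 = (csc x)\<^sup>2 - 1"
  using assms by (simp add: cot_def csc_def power_divide cos_squared_eq field_simps)

text \<open>Differentiating \<open>x csc x\<close> four times at \<open>x = \<pi> t\<close>, each time eliminating \<open>cot\<^sup>2\<close> in favour of
  \<open>csc\<^sup>2\<close>, leaves expressions of degree at most one in \<open>cot\<close>.\<close>
lemma logistic_moments:
  fixes t :: real
  assumes "- 1 < t" "t < 1" "t \<noteq> 0"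
  defines "k \<equiv> csc (pi * t)" and "c \<equiv> cot (pi * t)"
  shows "logistic_moment 0 t = pi * t * k"
    and "logistic_moment 1 t = pi * (k - pi * t * k * c)"
    and "logistic_moment 2 t = pi\<^sup>2 * (pi * t * k * (2 * k\<^sup>2 - 1) - 2 * k * c)"
    and "logistic_moment 3 t = pi ^ 3 * (3 * k * (2 * k\<^sup>2 - 1) - pi * t * k * c * (6 * k\<^sup>2 - 1))"
    and "logistic_moment 4 t = pi ^ 4 * (pi * t * k * (24 * k ^ 4 - 20 * k\<^sup>2 + 1) - 4 * k * c * (6 * k\<^sup>2 - 1))"
proof -
  let ?S = "{- 1<..<1} - {0 :: real}"
  let ?k = "\<lambda>t. csc (pi * t)" and ?c = "\<lambda>t. cot (pi * t)"
  have S: "open ?S" "?S \<subseteq> {- 1<..<1}" by (auto intro: open_Diff)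
  have nz: "sin (pi * s) \<noteq> 0" if "s \<in> ?S" for s
    using that sin_pi_times_nonzero by auto
  have dk: "(?k has_real_derivative - pi * ?k s * ?c s) (at s)" if "s \<in> ?S" for s
    using DERIV_chain2[where f = csc and g = "\<lambda>s. pi * s", OF DERIV_csc[OF nz[OF that]] DERIV_cmult_Id]
    by (simp add: algebra_simps)
  have dc: "(?c has_real_derivative - pi * (?k s)\<^sup>2) (at s)" if "s \<in> ?S" for s
    using DERIV_chain2[where f = cot and g = "\<lambda>s. pi * s", OF DERIV_cot_csc[OF nz[OF that]] DERIV_cmult_Id]
    by (simp add: algebra_simps)
  have c2: "(?c s)\<^sup>2 = (?k s)\<^sup>2 - 1" if "s \<in> ?S" for s
    using cot_squared nz that by blast
  note deriv = derivative_eq_intros dk dc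
  have m0: "logistic_moment 0 s = pi * s * ?k s" if "s \<in> ?S" for s
    using that logistic_exponential_moment[of s] Beta_reflection[of s]
    by (simp add: logistic_moment_def integral_logistic has_bochner_integral_iff csc_def)
  have m1: "logistic_moment (Suc 0) s = pi * (?k s - pi * s * ?k s * ?c s)" if "s \<in> ?S" for s
  proof (rule logistic_moment_Suc_eq[OF S that m0])
    show "((\<lambda>s. pi * s * ?k s) has_real_derivative pi * (?k s - pi * s * ?k s * ?c s)) (at s)"
      by (auto intro!: deriv that) algebra
  qed auto
  have m2: "logistic_moment (Suc (Suc 0)) s
      = pi\<^sup>2 * (pi * s * ?k s * (2 * (?k s)\<^sup>2 - 1) - 2 * ?k s * ?c s)" if "s \<in> ?S" for s
  proof (rule logistic_moment_Suc_eq[OF S that m1])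
    show "((\<lambda>s. pi * (?k s - pi * s * ?k s * ?c s)) has_real_derivative
        pi\<^sup>2 * (pi * s * ?k s * (2 * (?k s)\<^sup>2 - 1) - 2 * ?k s * ?c s)) (at s)"
      using c2[OF that]
      by (auto intro!: deriv that) algebra
  qed auto
  have m3: "logistic_moment (Suc (Suc (Suc 0))) s
      = pi ^ 3 * (3 * ?k s * (2 * (?k s)\<^sup>2 - 1) - pi * s * ?k s * ?c s * (6 * (?k s)\<^sup>2 - 1))"
    if "s \<in> ?S" for s
  proof (rule logistic_moment_Suc_eq[OF S that m2])
    show "((\<lambda>s. pi\<^sup>2 * (pi * s * ?k s * (2 * (?k s)\<^sup>2 - 1) - 2 * ?k s * ?c s)) has_real_derivative
        pi ^ 3 * (3 * ?k s * (2 * (?k s)\<^sup>2 - 1) - pi * s * ?k s * ?c s * (6 * (?k s)\<^sup>2 - 1))) (at s)"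
      using c2[OF that]
      by (auto intro!: deriv that) algebra
  qed auto
  have m4: "logistic_moment (Suc (Suc (Suc (Suc 0)))) s
      = pi ^ 4 * (pi * s * ?k s * (24 * ?k s ^ 4 - 20 * (?k s)\<^sup>2 + 1) - 4 * ?k s * ?c s * (6 * (?k s)\<^sup>2 - 1))"
    if "s \<in> ?S" for s
  proof (rule logistic_moment_Suc_eq[OF S that m3])
    show "((\<lambda>s. pi ^ 3 * (3 * ?k s * (2 * (?k s)\<^sup>2 - 1) - pi * s * ?k s * ?c s * (6 * (?k s)\<^sup>2 - 1)))
        has_real_derivative
        pi ^ 4 * (pi * s * ?k s * (24 * ?k s ^ 4 - 20 * (?k s)\<^sup>2 + 1) - 4 * ?k s * ?c s * (6 * (?k s)\<^sup>2 - 1))) (at s)"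
      using c2[OF that]
      by (auto intro!: deriv that) algebra
  qed auto
  have "t \<in> ?S" using assms by auto
  from m0[OF this] m1[OF this] m2[OF this] m3[OF this] m4[OF this]
  show "logistic_moment 0 t = pi * t * k"
    and "logistic_moment 1 t = pi * (k - pi * t * k * c)"
    and "logistic_moment 2 t = pi\<^sup>2 * (pi * t * k * (2 * k\<^sup>2 - 1) - 2 * k * c)"
    and "logistic_moment 3 t = pi ^ 3 * (3 * k * (2 * k\<^sup>2 - 1) - pi * t * k * c * (6 * k\<^sup>2 - 1))"
    and "logistic_moment 4 t = pi ^ 4 * (pi * t * k * (24 * k ^ 4 - 20 * k\<^sup>2 + 1) - 4 * k * c * (6 * k\<^sup>2 - 1))"
    unfolding k_def c_def by (simp_all add: eval_nat_numeral)
qed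

section \<open>The moment generating function of the skew logistic distribution\<close>

text \<open>The coefficients are those of the quartic \<open>((1 - \<alpha> z)\<^sup>2 + 1)\<^sup>2\<close>.  Unlike the formula with \<open>csc\<close> and
  \<open>cot\<close>, this expression has the right value at \<open>t = 0\<close> as well.\<close>
definition logistic_moment_mixture :: "real \<Rightarrow> real \<Rightarrow> real"
  where "logistic_moment_mixture \<alpha> t =
    (4 * logistic_moment 0 t - 8 * \<alpha> * logistic_moment 1 t + 8 * \<alpha>\<^sup>2 * logistic_moment 2 t
      - 4 * \<alpha> ^ 3 * logistic_moment 3 t + \<alpha> ^ 4 * logistic_moment 4 t) / C2 \<alpha>"

text \<open>With the closed forms of the moments inserted, both sides are polynomials in \<open>t\<close>, \<open>\<alpha>\<close>, \<open>\<pi>\<close>,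
  \<open>csc (\<pi> t)\<close>, \<open>cot (\<pi> t)\<close> and the inverse of \<open>C\<^sub>2(\<alpha>)\<close>, and they agree as such.\<close>
lemma baslg2_mgf_formula_eq_mixture:
  assumes "- 1 < t" "t < 1" "t \<noteq> 0"
  shows "baslg2_mgf_formula \<alpha> t = logistic_moment_mixture \<alpha> t"
  unfolding baslg2_mgf_formula_def logistic_moment_mixture_def logistic_moments[OF assms]
  by (simp add: divide_inverse) algebra

lemma C2_pos: "C2 \<alpha> > 0"
  unfolding C2_def by (intro add_pos_nonneg) auto

lemma baslg2_density_nonneg: "0 \<le> baslg2_density \<alpha> z"
  using C2_pos[of \<alpha>] by (simp add: baslg2_density_def)

lemma baslg2_density_expand:
  "baslg2_density \<alpha> z * y = logistic_density z *
    ((4 * (z ^ 0 * y) - 8 * \<alpha> * (z ^ 1 * y) + 8 * \<alpha>\<^sup>2 * (z ^ 2 * y)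
      - 4 * \<alpha> ^ 3 * (z ^ 3 * y) + \<alpha> ^ 4 * (z ^ 4 * y)) / C2 \<alpha>)"
proof -
  have "((1 - \<alpha> * z)\<^sup>2 + 1)\<^sup>2 * y
      = 4 * (z ^ 0 * y) - 8 * \<alpha> * (z ^ 1 * y) + 8 * \<alpha>\<^sup>2 * (z ^ 2 * y)
      - 4 * \<alpha> ^ 3 * (z ^ 3 * y) + \<alpha> ^ 4 * (z ^ 4 * y)"
    by simp algebra
  then show ?thesis
    by (simp add: baslg2_density_def logistic_density_def mult_ac)
qed

lemma baslg2_mgf_eq_mixture:
  assumes "baslg2_distributed M Z \<alpha>" "- 1 < t" "t < 1"
  shows "integrable M (\<lambda>\<omega>. exp (t * Z \<omega>))"
    and "mgf M Z t = logistic_moment_mixture \<alpha> t"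
proof -
  let ?h = "\<lambda>z. (4 * (z ^ 0 * exp (t * z)) - 8 * \<alpha> * (z ^ 1 * exp (t * z)) + 8 * \<alpha>\<^sup>2 * (z ^ 2 * exp (t * z))
      - 4 * \<alpha> ^ 3 * (z ^ 3 * exp (t * z)) + \<alpha> ^ 4 * (z ^ 4 * exp (t * z))) / C2 \<alpha>"
  have D: "distributed M lborel Z (\<lambda>z. ennreal (baslg2_density \<alpha> z))"
    using assms(1) by (simp add: baslg2_distributed_def)
  have int: "integrable logistic (\<lambda>z. z ^ n * exp (t * z))" for n
    using integrable_logistic_power_times_exp assms by blast
  have h: "has_bochner_integral logistic ?h (logistic_moment_mixture \<alpha> t)"
    unfolding logistic_moment_mixture_def logistic_moment_def
    by (intro has_bochner_integral_divide_zero has_bochner_integral_add has_bochner_integral_diff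
          has_bochner_integral_mult_right has_bochner_integral_integrable int)
  show "integrable M (\<lambda>\<omega>. exp (t * Z \<omega>))"
    using h by (subst distributed_integrable[OF D, symmetric])
      (auto simp: baslg2_density_nonneg baslg2_density_expand has_bochner_integral_iff integrable_logistic_iff)
  have "mgf M Z t = (LINT z|lborel. baslg2_density \<alpha> z * exp (t * z))"
    unfolding mgf_def by (subst distributed_integral[OF D]) (auto simp: baslg2_density_nonneg)
  also have "\<dots> = integral\<^sup>L logistic ?h"
    by (simp only: baslg2_density_expand) (rule integral_logistic[symmetric], measurable)
  finally show "mgf M Z t = logistic_moment_mixture \<alpha> t"
    using h by (simp add: has_bochner_integral_iff)
qed

lemma isCont_logistic_moment_mixture:
  assumes "- 1 < t" "t < 1"
  shows "isCont (logistic_moment_mixture \<alpha>) t"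
  using C2_pos[of \<alpha>] unfolding logistic_moment_mixture_def[abs_def]
  by (intro continuous_intros DERIV_isCont[OF DERIV_logistic_moment[OF assms]]) auto

theorem theorem3:
  fixes M :: "'a measure" and Z :: "'a \<Rightarrow> real" and \<alpha> t :: real
  assumes "prob_space M"
    and "baslg2_distributed M Z \<alpha>"
    and "- 1 < t" and "t < 1"
  shows "integrable M (\<lambda>\<omega>. exp (t * Z \<omega>))
    \<and> (t \<noteq> 0 \<longrightarrow> mgf M Z t = baslg2_mgf_formula \<alpha> t)
    \<and> (t = 0 \<longrightarrow> (baslg2_mgf_formula \<alpha> \<longlongrightarrow> mgf M Z t) (at 0))"
proof (intro conjI impI)
  note mgf = baslg2_mgf_eq_mixture[OF assms(2-4)]
  show "integrable M (\<lambda>\<omega>. exp (t * Z \<omega>))"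
    by (fact mgf(1))
  show "mgf M Z t = baslg2_mgf_formula \<alpha> t" if "t \<noteq> 0"
    using mgf(2) baslg2_mgf_formula_eq_mixture that assms(3,4) by simp
  show "(baslg2_mgf_formula \<alpha> \<longlongrightarrow> mgf M Z t) (at 0)" if "t = 0"
  proof (rule Lim_transform_within_open)
    show "(logistic_moment_mixture \<alpha> \<longlongrightarrow> mgf M Z t) (at 0)"
      using isCont_logistic_moment_mixture[of 0 \<alpha>] mgf(2) that by (simp add: isCont_def)
  qed (use baslg2_mgf_formula_eq_mixture in \<open>auto intro: open_greaterThanLessThan[of "- 1" 1]\<close>)
qed

end
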